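(* Let $(Q,+)$ be a group, $\varphi,\psi\in Aut(Q,+)$, $c\in Q$, and let $(Q,A)$ be the linear quasigroup $A(x,y)=\varphi x+\psi y+c$. Then the following equivalences hold: 1. $A\bot A^{(12)}$ if and only if for every $t\in Q$ the map $(-J_t\varphi^{-1}\psi+\psi^{-1}\varphi)$ is a permutation of $Q$; 2. $A\bot A^{(13)}$ if and only if the map $(\varphi+\varepsilon)$ is a permutation of $Q$; 3. $A\bot A^{(23)}$ if and only if the map $(\varepsilon+\psi)$ is a permutation of $Q$; 4. $A\bot A^{(123)}$ if and only if the map $(\varphi+\psi^2)$ is a permutation of $Q$; 5. $A\bot A^{(132)}$ if and only if the map $(\varphi^2+\psi)$ is a permutation of $Q$.
   Context: Groups are written additively but need not be commutative. Products of maps are compositions; sums of maps are pointwise in the written order: $(f+g)x=fx+gx$, $(-f+g)x=-(fx)+gx$. A permutation of $Q$ is a bijection $Q\to Q$; $\varepsilon$ is the identity map; $J_tx=t+x-t$ for $t\in Q$. The parastrophes of a quasigroup $(Q,A)$ are the quasigroup operations defined by: $A(x_1,x_2)=x_3\Leftrightarrow A^{(12)}(x_2,x_1)=x_3\Leftrightarrow A^{(13)}(x_3,x_2)=x_1\Leftrightarrow A^{(23)}(x_1,x_3)=x_2\Leftrightarrow A^{(123)}(x_2,x_3)=x_1\Leftrightarrow A^{(132)}(x_3,x_1)=x_2$. For quasigroup operations $A,B$ on $Q$, $A\bot B$ ($A$ and $B$ are orthogonal) means that for all $a,b\in Q$ the system $A(x,y)=a$, $B(x,y)=b$ has a unique solution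 $(x,y)\in Q\times Q$. *)

theory Defs
  imports "HOL-Algebra.Group"
begin

definition quasigroup_on :: "'a set \<Rightarrow> ('a \<Rightarrow> 'a \<Rightarrow> 'a) \<Rightarrow> bool" where
  "quasigroup_on Q A \<longleftrightarrow>
     (\<forall>x\<in>Q. \<forall>y\<in>Q. A x y \<in> Q) \<and>
     (\<forall>y\<in>Q. \<forall>z\<in>Q. \<exists>!x. x \<in> Q \<and> A x y = z) \<and>
     (\<forall>x\<in>Q. \<forall>z\<in>Q. \<exists>!y. y \<in> Q \<and> A x y = z)"

text \<open>
  The argument names follow the equivalences that define the parastrophes, all of which are
  statements about \<open>A x1 x2 = x3\<close>. For a quasigroup the descriptions below are well-defined;
  the defining equivalences are the lemmas \<open>parastrophe_12_iff\<close> to \<open>parastrophe_132_iff\<close>.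
\<close>

definition parastrophe_12 :: "('a \<Rightarrow> 'a \<Rightarrow> 'a) \<Rightarrow> 'a \<Rightarrow> 'a \<Rightarrow> 'a" where
  "parastrophe_12 A x2 x1 = A x1 x2"

definition parastrophe_13 :: "'a set \<Rightarrow> ('a \<Rightarrow> 'a \<Rightarrow> 'a) \<Rightarrow> 'a \<Rightarrow> 'a \<Rightarrow> 'a" where
  "parastrophe_13 Q A x3 x2 = (THE x1. x1 \<in> Q \<and> A x1 x2 = x3)"

definition parastrophe_23 :: "'a set \<Rightarrow> ('a \<Rightarrow> 'a \<Rightarrow> 'a) \<Rightarrow> 'a \<Rightarrow> 'a \<Rightarrow> 'a" where
  "parastrophe_23 Q A x1 x3 = (THE x2. x2 \<in> Q \<and> A x1 x2 = x3)"

definition parastrophe_123 :: "'a set \<Rightarrow> ('a \<Rightarrow> 'a \<Rightarrow> 'a) \<Rightarrow> 'a \<Rightarrow> 'a \<Rightarrow> 'a" where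
  "parastrophe_123 Q A x2 x3 = (THE x1. x1 \<in> Q \<and> A x1 x2 = x3)"

definition parastrophe_132 :: "'a set \<Rightarrow> ('a \<Rightarrow> 'a \<Rightarrow> 'a) \<Rightarrow> 'a \<Rightarrow> 'a \<Rightarrow> 'a" where
  "parastrophe_132 Q A x3 x1 = (THE x2. x2 \<in> Q \<and> A x1 x2 = x3)"

definition orthogonal_on :: "'a set \<Rightarrow> ('a \<Rightarrow> 'a \<Rightarrow> 'a) \<Rightarrow> ('a \<Rightarrow> 'a \<Rightarrow> 'a) \<Rightarrow> bool" where
  "orthogonal_on Q A B \<longleftrightarrow>
     (\<forall>a\<in>Q. \<forall>b\<in>Q. \<exists>!(x, y). (x, y) \<in> Q \<times> Q \<and> A x y = a \<and> B x y = b)"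

text \<open>HOL-Algebra writes the (not necessarily commutative) group operation multiplicatively:
  \<open>x \<otimes> y\<close> and \<open>inv x\<close> stand for \<open>x + y\<close> and \<open>-x\<close>.\<close>

definition conj_map :: "('a, 'b) monoid_scheme \<Rightarrow> 'a \<Rightarrow> 'a \<Rightarrow> 'a" where
  "conj_map G t x = t \<otimes>\<^bsub>G\<^esub> x \<otimes>\<^bsub>G\<^esub> inv\<^bsub>G\<^esub> t"

definition pointwise_sum :: "('a, 'b) monoid_scheme \<Rightarrow> ('a \<Rightarrow> 'a) \<Rightarrow> ('a \<Rightarrow> 'a) \<Rightarrow> 'a \<Rightarrow> 'a" where
  "pointwise_sum G f g x = f x \<otimes>\<^bsub>G\<^esub> g x"

definition pointwise_neg :: "('a, 'b) monoid_scheme \<Rightarrow> ('a \<Rightarrow> 'a) \<Rightarrow> 'a \<Rightarrow> 'a" where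
  "pointwise_neg G f x = inv\<^bsub>G\<^esub> (f x)"

lemma parastrophe_12_iff:
  "parastrophe_12 A x2 x1 = x3 \<longleftrightarrow> A x1 x2 = x3"
  by (simp add: parastrophe_12_def)

context
  fixes Q :: "'a set" and A x1 x2 x3
  assumes A: "quasigroup_on Q A" and x: "x1 \<in> Q" "x2 \<in> Q" "x3 \<in> Q"
begin

lemma parastrophe_13_iff: "parastrophe_13 Q A x3 x2 = x1 \<longleftrightarrow> A x1 x2 = x3"
proof -
  have "\<exists>!x. x \<in> Q \<and> A x x2 = x3"
    using A x by (simp add: quasigroup_on_def)
  from theI'[OF this] this show ?thesis
    using x unfolding parastrophe_13_def by blast
qed

lemma parastrophe_23_iff: "parastrophe_23 Q A x1 x3 = x2 \<longleftrightarrow> A x1 x2 = x3"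
proof -
  have "\<exists>!y. y \<in> Q \<and> A x1 y = x3"
    using A x by (simp add: quasigroup_on_def)
  from theI'[OF this] this show ?thesis
    using x unfolding parastrophe_23_def by blast
qed

lemma parastrophe_123_iff: "parastrophe_123 Q A x2 x3 = x1 \<longleftrightarrow> A x1 x2 = x3"
  using parastrophe_13_iff by (simp add: parastrophe_13_def parastrophe_123_def)

lemma parastrophe_132_iff: "parastrophe_132 Q A x3 x1 = x2 \<longleftrightarrow> A x1 x2 = x3"
  using parastrophe_23_iff by (simp add: parastrophe_23_def parastrophe_132_def)

end

lemma (in group) linear_quasigroup:
  assumes \<phi>: "\<phi> \<in> iso G G" and \<psi>: "\<psi> \<in> iso G G" and c: "c \<in> carrier G"
    and A: "\<And>x y. x \<in> carrier G \<Longrightarrow> y \<in> carrier G \<Longrightarrow> A x y = \<phi> x \<otimes> \<psi> y \<otimes> c"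
  shows "quasigroup_on (carrier G) A"
proof -
  have b: "bij_betw \<phi> (carrier G) (carrier G)" "bij_betw \<psi> (carrier G) (carrier G)"
    using \<phi> \<psi> by (auto simp: iso_def)
  have ex1: "\<exists>!x. x \<in> carrier G \<and> f x = z"
    if "bij_betw f (carrier G) (carrier G)" "z \<in> carrier G" for f z
  proof -
    have "z \<in> f ` carrier G" and "inj_on f (carrier G)"
      using that by (auto simp: bij_betw_def)
    then show ?thesis unfolding inj_on_def by blast
  qed
  from b have cl: "\<phi> x \<in> carrier G" "\<psi> x \<in> carrier G" if "x \<in> carrier G" for x
    using that by (auto dest: bij_betwE)
  have "A x y \<in> carrier G" if "x \<in> carrier G" "y \<in> carrier G" for x y
    using that c cl by (simp add: A)
  moreover have "\<exists>!x. x \<in> carrier G \<and> A x y = z" if yz: "y \<in> carrier G" "z \<in> carrier G" for y z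
  proof -
    have "A x y = z \<longleftrightarrow> \<phi> x = z \<otimes> inv (\<psi> y \<otimes> c)" if "x \<in> carrier G" for x
    proof -
      have "\<phi> x = z \<otimes> inv (\<psi> y \<otimes> c) \<longleftrightarrow> z = \<phi> x \<otimes> (\<psi> y \<otimes> c)"
        using that yz c cl by (intro inv_solve_right) simp_all
      moreover have "A x y = \<phi> x \<otimes> (\<psi> y \<otimes> c)"
        using that yz c cl by (simp add: A m_assoc)
      ultimately show ?thesis by metis
    qed
    moreover have "z \<otimes> inv (\<psi> y \<otimes> c) \<in> carrier G"
      using yz c cl by simp
    then have "\<exists>!x. x \<in> carrier G \<and> \<phi> x = z \<otimes> inv (\<psi> y \<otimes> c)"
      by (rule ex1[OF b(1)])
    ultimately show ?thesis by (simp cong: conj_cong)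
  qed
  moreover have "\<exists>!y. y \<in> carrier G \<and> A x y = z" if xz: "x \<in> carrier G" "z \<in> carrier G" for x z
  proof -
    have "A x y = z \<longleftrightarrow> \<psi> y = inv (\<phi> x) \<otimes> (z \<otimes> inv c)" if "y \<in> carrier G" for y
    proof -
      have "\<psi> y = inv (\<phi> x) \<otimes> (z \<otimes> inv c) \<longleftrightarrow> z \<otimes> inv c = \<phi> x \<otimes> \<psi> y"
        using that xz c cl by (intro inv_solve_left) simp_all
      moreover have "\<phi> x \<otimes> \<psi> y = z \<otimes> inv c \<longleftrightarrow> z = \<phi> x \<otimes> \<psi> y \<otimes> c"
        using that xz c cl by (intro inv_solve_right) simp_all
      moreover have "A x y = \<phi> x \<otimes> \<psi> y \<otimes> c"
        using that xz by (simp add: A)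
      ultimately show ?thesis by metis
    qed
    moreover have "inv (\<phi> x) \<otimes> (z \<otimes> inv c) \<in> carrier G"
      using xz c cl by simp
    then have "\<exists>!y. y \<in> carrier G \<and> \<psi> y = inv (\<phi> x) \<otimes> (z \<otimes> inv c)"
      by (rule ex1[OF b(2)])
    ultimately show ?thesis by (simp cong: conj_cong)
  qed
  ultimately show ?thesis
    by (simp add: quasigroup_on_def)
qed

end

theory Submission
  imports Defs
begin

text \<open>
  For a parastrophe \<open>B\<close> of \<open>A\<close>, the equation \<open>B x y = b\<close> can be solved for one of the unknowns, say
  \<open>y = g b x\<close>, so \<open>A\<close> and \<open>B\<close> are orthogonal iff \<open>x \<mapsto> A x (g b x)\<close> is a permutation for every \<open>b\<close>.
  In each case this map factors as \<open>L \<circ> f \<circ> R\<close>, where \<open>f\<close> is the map in the theorem and \<open>L\<close>, \<open>R\<close>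
  are permutations composed of translations, automorphisms and (for the first parastrophe) inversion.
\<close>

lemma bij_betw_iff_ex1:
  "bij_betw f A B \<longleftrightarrow> (\<forall>a\<in>A. f a \<in> B) \<and> (\<forall>b\<in>B. \<exists>!a. a \<in> A \<and> f a = b)"
  unfolding bij_betw_def inj_on_def by blast

lemma ex1_pair_iff:
  "(\<exists>!(x, y). P x y) \<longleftrightarrow> (\<exists>x y. P x y \<and> (\<forall>x' y'. P x' y' \<longrightarrow> x' = x \<and> y' = y))"
  by (simp add: Ex1_def)

lemma ex1_pair_eq_snd: "(\<exists>!(x, y). P x \<and> y = h x) \<longleftrightarrow> (\<exists>!x. P x)"
  unfolding ex1_pair_iff Ex1_def by blast

lemma ex1_pair_swap: "(\<exists>!(x, y). P x y) \<longleftrightarrow> (\<exists>!(x, y). P y x)"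
  unfolding ex1_pair_iff by blast

text \<open>Closure under \<open>A\<close> and \<open>g\<close> keeps the substituted map inside
  \<open>Q\<close>, so unique solvability for every \<open>a\<close> in \<open>Q\<close> amounts to
  bijectivity.\<close>

lemma orthogonal_on_iff_bij_betw_snd:
  assumes A: "\<And>x y. x \<in> Q \<Longrightarrow> y \<in> Q \<Longrightarrow> A x y \<in> Q"
    and g: "\<And>b x. b \<in> Q \<Longrightarrow> x \<in> Q \<Longrightarrow> g b x \<in> Q"
    and B: "\<And>x y b. x \<in> Q \<Longrightarrow> y \<in> Q \<Longrightarrow> b \<in> Q \<Longrightarrow> B x y = b \<longleftrightarrow> y = g b x"
  shows "orthogonal_on Q A B \<longleftrightarrow> (\<forall>b\<in>Q. bij_betw (\<lambda>x. A x (g b x)) Q Q)"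
proof -
  have "(\<exists>!(x, y). (x, y) \<in> Q \<times> Q \<and> A x y = a \<and> B x y = b) \<longleftrightarrow>
      (\<exists>!x. x \<in> Q \<and> A x (g b x) = a)" if "b \<in> Q" for a b
  proof -
    have "(x, y) \<in> Q \<times> Q \<and> A x y = a \<and> B x y = b \<longleftrightarrow>
        (x \<in> Q \<and> A x (g b x) = a) \<and> y = g b x" for x y
      using B[of x y b] g[of b x] that by (cases "y = g b x") auto
    then have "(\<exists>!(x, y). (x, y) \<in> Q \<times> Q \<and> A x y = a \<and> B x y = b) \<longleftrightarrow>
        (\<exists>!(x, y). (x \<in> Q \<and> A x (g b x) = a) \<and> y = g b x)"
      by simp
    then show ?thesis
      by (simp only: ex1_pair_eq_snd)
  qed
  then have "orthogonal_on Q A B \<longleftrightarrow> (\<forall>a\<in>Q. \<forall>b\<in>Q. \<exists>!x. x \<in> Q \<and> A x (g b x) = a)"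
    by (simp add: orthogonal_on_def)
  moreover have "\<forall>x\<in>Q. A x (g b x) \<in> Q" if "b \<in> Q" for b
    using that A g by simp
  ultimately show ?thesis
    unfolding bij_betw_iff_ex1 by meson
qed

text \<open>Exchanging the unknowns swaps the coordinates of every solution; this turns the
  elimination of \<open>y\<close> into an elimination of \<open>x\<close>.\<close>

lemma orthogonal_on_swap:
  "orthogonal_on Q A B \<longleftrightarrow> orthogonal_on Q (\<lambda>x y. A y x) (\<lambda>x y. B y x)"
proof -
  have "(\<exists>!(x, y). (x, y) \<in> Q \<times> Q \<and> A x y = a \<and> B x y = b) \<longleftrightarrow>
      (\<exists>!(x, y). (y, x) \<in> Q \<times> Q \<and> A y x = a \<and> B y x = b)" for a b
    by (rule ex1_pair_swap)
  moreover have "(y, x) \<in> Q \<times> Q \<longleftrightarrow> (x, y) \<in> Q \<times> Q" for x y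
    by auto
  ultimately show ?thesis
    by (simp only: orthogonal_on_def)
qed

lemma orthogonal_on_iff_bij_betw_fst:
  assumes "\<And>x y. x \<in> Q \<Longrightarrow> y \<in> Q \<Longrightarrow> A x y \<in> Q"
    and "\<And>b y. b \<in> Q \<Longrightarrow> y \<in> Q \<Longrightarrow> g b y \<in> Q"
    and "\<And>x y b. x \<in> Q \<Longrightarrow> y \<in> Q \<Longrightarrow> b \<in> Q \<Longrightarrow> B x y = b \<longleftrightarrow> x = g b y"
  shows "orthogonal_on Q A B \<longleftrightarrow> (\<forall>b\<in>Q. bij_betw (\<lambda>y. A (g b y) y) Q Q)"
  unfolding orthogonal_on_swap[of Q A B]
  using assms by (intro orthogonal_on_iff_bij_betw_snd) auto

text \<open>Permutations cancel from either side of a composition. Closure of \<open>f\<close>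
  allows \<open>L\<close> to be cancelled, since \<open>L\<close> is known to be injective only on
  \<open>Q\<close>.\<close>

lemma bij_betw_sandwich_iff:
  assumes L: "bij_betw L Q Q" and R: "bij_betw R Q Q" and f: "\<And>x. x \<in> Q \<Longrightarrow> f x \<in> Q"
    and F: "\<And>x. x \<in> Q \<Longrightarrow> F x = L (f (R x))"
  shows "bij_betw F Q Q \<longleftrightarrow> bij_betw f Q Q"
proof -
  have "bij_betw F Q Q \<longleftrightarrow> bij_betw (L \<circ> (f \<circ> R)) Q Q"
    using F by (intro bij_betw_cong) simp
  also have "\<dots> \<longleftrightarrow> bij_betw (f \<circ> R) Q Q"
    using bij_betwE[OF R] f by (intro bij_betw_comp_iff2[OF L, symmetric]) auto
  also have "\<dots> \<longleftrightarrow> bij_betw f Q Q"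
    by (rule bij_betw_comp_iff[OF R, symmetric])
  finally show ?thesis .
qed

lemma (in group) bij_betw_mult_left:
  assumes "g \<in> carrier G" shows "bij_betw (\<lambda>x. g \<otimes> x) (carrier G) (carrier G)"
  by (rule bij_betw_byWitness[where f' = "\<lambda>x. inv g \<otimes> x"])
    (use assms in \<open>auto simp: m_assoc[symmetric]\<close>)

lemma (in group) bij_betw_mult_right:
  assumes "g \<in> carrier G" shows "bij_betw (\<lambda>x. x \<otimes> g) (carrier G) (carrier G)"
  by (rule bij_betw_byWitness[where f' = "\<lambda>x. x \<otimes> inv g"]) (use assms in \<open>auto simp: m_assoc\<close>)

lemma (in group) bij_betw_m_inv: "bij_betw (\<lambda>x. inv x) (carrier G) (carrier G)"
  by (rule bij_betw_byWitness[where f' = "\<lambda>x. inv x"]) auto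

text \<open>Once \<open>m_assoc\<close> has nested products to the right, these rules cancel a
  factor against its inverse inside a longer product.\<close>

lemma (in group) inv_cancel_left:
  "x \<in> carrier G \<Longrightarrow> y \<in> carrier G \<Longrightarrow> x \<otimes> (inv x \<otimes> y) = y"
  "x \<in> carrier G \<Longrightarrow> y \<in> carrier G \<Longrightarrow> inv x \<otimes> (x \<otimes> y) = y"
  by (simp_all add: m_assoc[symmetric])

theorem theorem48:
  fixes G :: "('a, 'b) monoid_scheme" (structure)
    and \<phi> \<psi> :: "'a \<Rightarrow> 'a" and c :: 'a and A :: "'a \<Rightarrow> 'a \<Rightarrow> 'a"
  assumes "group G"
    and "\<phi> \<in> iso G G" and "\<psi> \<in> iso G G" and "c \<in> carrier G"
    and "\<And>x y. x \<in> carrier G \<Longrightarrow> y \<in> carrier G \<Longrightarrow> A x y = \<phi> x \<otimes> \<psi> y \<otimes> c"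
  shows "(orthogonal_on (carrier G) A (parastrophe_12 A) \<longleftrightarrow>
            (\<forall>t \<in> carrier G.
               bij_betw
                 (pointwise_sum G
                   (pointwise_neg G (conj_map G t \<circ> inv_into (carrier G) \<phi> \<circ> \<psi>))
                   (inv_into (carrier G) \<psi> \<circ> \<phi>))
                 (carrier G) (carrier G)))
       \<and> (orthogonal_on (carrier G) A (parastrophe_13 (carrier G) A) \<longleftrightarrow>
            bij_betw (pointwise_sum G \<phi> id) (carrier G) (carrier G))
       \<and> (orthogonal_on (carrier G) A (parastrophe_23 (carrier G) A) \<longleftrightarrow>
            bij_betw (pointwise_sum G id \<psi>) (carrier G) (carrier G))
       \<and> (orthogonal_on (carrier G) A (parastrophe_123 (carrier G) A) \<longleftrightarrow>
            bij_betw (pointwise_sum G \<phi> (\<psi> \<circ> \<psi>)) (carrier G) (carrier G))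
       \<and> (orthogonal_on (carrier G) A (parastrophe_132 (carrier G) A) \<longleftrightarrow>
            bij_betw (pointwise_sum G (\<phi> \<circ> \<phi>) \<psi>) (carrier G) (carrier G))"
proof -
  interpret group G by fact
  let ?Q = "carrier G"
  note A = assms(5) and c = \<open>c \<in> ?Q\<close>
  have q: "quasigroup_on ?Q A"
    by (rule linear_quasigroup[OF assms(2-5)])
  have b: "bij_betw \<phi> ?Q ?Q" "bij_betw \<psi> ?Q ?Q"
    using assms(2,3) by (auto simp: iso_def)
  define \<phi>' \<psi>' where "\<phi>' = inv_into ?Q \<phi>" and "\<psi>' = inv_into ?Q \<psi>"
  have iso': "\<phi>' \<in> iso G G" "\<psi>' \<in> iso G G"
    unfolding \<phi>'_def \<psi>'_def using assms(2,3) by (auto intro: iso_set_sym)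
  have cl[simp]: "\<phi> x \<in> ?Q" "\<psi> x \<in> ?Q" "\<phi>' x \<in> ?Q" "\<psi>' x \<in> ?Q" if "x \<in> ?Q" for x
    using that assms(2,3) iso' by (auto simp: iso_def hom_def)
  have inverse[simp]: "\<phi>' (\<phi> x) = x" "\<psi>' (\<psi> x) = x" "\<phi> (\<phi>' x) = x" "\<psi> (\<psi>' x) = x" if "x \<in> ?Q" for x
    using that bij_betw_inv_into_left[OF b(1)] bij_betw_inv_into_left[OF b(2)]
      bij_betw_inv_into_right[OF b(1)] bij_betw_inv_into_right[OF b(2)]
    by (auto simp: \<phi>'_def \<psi>'_def)
  have h: "group_hom G G \<phi>" "group_hom G G \<psi>" "group_hom G G \<phi>'" "group_hom G G \<psi>'"
    using assms(2,3) iso' by (auto intro!: group_hom.intro simp: group_hom_axioms_def iso_def)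
  note hom[simp] = h[THEN group_hom.hom_mult] h[THEN group_hom.hom_inv]
  have Ac: "A x y \<in> ?Q" if "x \<in> ?Q" "y \<in> ?Q" for x y
    using that c by (simp add: A)
  \<comment> \<open>Together with the simp rules for homomorphisms and inverse maps, these reduce
    both sides of each factorisation to the same right-nested product.\<close>
  note simps = A c m_assoc inv_mult_group inv_cancel_left pointwise_sum_def pointwise_neg_def
    conj_map_def

  let ?f = "\<lambda>t. pointwise_sum G (pointwise_neg G (conj_map G t \<circ> \<phi>' \<circ> \<psi>)) (\<psi>' \<circ> \<phi>)"
  \<comment> \<open>Since \<open>parastrophe_12 A x y\<close> is \<open>A y x\<close>, the formula
    for \<open>y\<close> comes from solving
    \<open>\<phi> y \<otimes> \<psi> x \<otimes> c = b\<close>.\<close>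
  have "orthogonal_on ?Q A (parastrophe_12 A) \<longleftrightarrow>
      (\<forall>b\<in>?Q. bij_betw (\<lambda>x. A x (\<phi>' (b \<otimes> inv c) \<otimes> inv (\<phi>' (\<psi> x)))) ?Q ?Q)"
  proof (rule orthogonal_on_iff_bij_betw_snd)
    fix x y b assume m: "x \<in> ?Q" "y \<in> ?Q" "b \<in> ?Q"
    have "parastrophe_12 A x y = b \<longleftrightarrow> \<phi> y = b \<otimes> inv (\<psi> x \<otimes> c)"
      using m inv_solve_right[of "\<phi> y" b "\<psi> x \<otimes> c"] by (auto simp: parastrophe_12_def simps)
    also have "\<dots> \<longleftrightarrow> y = \<phi>' (b \<otimes> inv (\<psi> x \<otimes> c))"
      using m c inverse(1)[of y] inverse(3)[of "b \<otimes> inv (\<psi> x \<otimes> c)"]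
      by (metis cl(2) m_closed inv_closed)
    finally show "parastrophe_12 A x y = b \<longleftrightarrow> y = \<phi>' (b \<otimes> inv c) \<otimes> inv (\<phi>' (\<psi> x))"
      using m by (simp add: simps)
  qed (use Ac c in auto)
  also have "\<dots> \<longleftrightarrow> (\<forall>b\<in>?Q. bij_betw (?f (\<phi>' (b \<otimes> inv c))) ?Q ?Q)"
  proof (rule ball_cong[OF refl])
    fix b assume m: "b \<in> ?Q"
    define t where "t = \<phi>' (b \<otimes> inv c)"
    have t: "t \<in> ?Q" using m c by (simp add: t_def)
    \<comment> \<open>Inverting the value of \<open>?f t\<close> at \<open>inv x\<close> reverses
      its factors and puts the term with \<open>\<phi> x\<close> first. Then \<open>\<psi>\<close>
      clears \<open>\<psi>'\<close>, and the right translation replaces the trailing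
      \<open>inv (\<psi> t)\<close> by \<open>c\<close>.\<close>
    have "bij_betw ((\<lambda>u. u \<otimes> (\<psi> t \<otimes> c)) \<circ> \<psi> \<circ> (\<lambda>x. inv x)) ?Q ?Q"
      using t c by (intro bij_betw_trans[OF bij_betw_m_inv] bij_betw_trans[OF b(2)] bij_betw_mult_right) auto
    then show "bij_betw (\<lambda>x. A x (\<phi>' (b \<otimes> inv c) \<otimes> inv (\<phi>' (\<psi> x)))) ?Q ?Q \<longleftrightarrow>
        bij_betw (?f (\<phi>' (b \<otimes> inv c))) ?Q ?Q"
      unfolding t_def[symmetric]
      by (rule bij_betw_sandwich_iff[OF _ bij_betw_m_inv]) (use t in \<open>simp_all add: simps\<close>)
  qed
  also have "\<dots> \<longleftrightarrow> (\<forall>t\<in>?Q. bij_betw (?f t) ?Q ?Q)"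
  proof -
    \<comment> \<open>Every \<open>t\<close> arises from \<open>b = \<phi> t \<otimes> c\<close>, so
      the parameter runs through the whole carrier.\<close>
    have "t = \<phi>' ((\<phi> t \<otimes> c) \<otimes> inv c)" if "t \<in> ?Q" for t
      using that c by (simp add: m_assoc)
    moreover have "\<phi> t \<otimes> c \<in> ?Q" if "t \<in> ?Q" for t using that c by simp
    moreover have "\<phi>' (b \<otimes> inv c) \<in> ?Q" if "b \<in> ?Q" for b using that c by simp
    ultimately show ?thesis by metis
  qed
  finally have 1: "orthogonal_on ?Q A (parastrophe_12 A) \<longleftrightarrow> (\<forall>t\<in>?Q. bij_betw (?f t) ?Q ?Q)" .

  \<comment> \<open>The equation \<open>parastrophe_13 ?Q A x y = b\<close> says
    \<open>x = A b y\<close>, so the unknown to eliminate is already isolated. The remaining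
    parastrophes work alike.\<close>
  have "orthogonal_on ?Q A (parastrophe_13 ?Q A) \<longleftrightarrow> (\<forall>b\<in>?Q. bij_betw (\<lambda>y. A (A b y) y) ?Q ?Q)"
    by (rule orthogonal_on_iff_bij_betw_fst) (use Ac parastrophe_13_iff[OF q] in auto)
  moreover have "bij_betw (\<lambda>y. A (A b y) y) ?Q ?Q \<longleftrightarrow> bij_betw (pointwise_sum G \<phi> id) ?Q ?Q"
    if m: "b \<in> ?Q" for b
  proof (rule bij_betw_sandwich_iff)
    show "bij_betw (\<lambda>u. \<phi> (\<phi> b) \<otimes> u) ?Q ?Q"
      using m by (intro bij_betw_mult_left) simp
    \<comment> \<open>The block \<open>\<psi> y \<otimes> c\<close> occurs twice in
      \<open>A (A b y) y\<close>, once under \<open>\<phi>\<close>, and serves as the new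
      variable.\<close>
    show "bij_betw ((\<lambda>y. y \<otimes> c) \<circ> \<psi>) ?Q ?Q"
      by (rule bij_betw_trans[OF b(2) bij_betw_mult_right[OF c]])
  qed (use m in \<open>simp_all add: simps\<close>)
  \<comment> \<open>The right-hand side does not depend on \<open>b\<close>. As \<open>c\<close>
    shows that the carrier is nonempty, the quantifier over \<open>b\<close> drops out.\<close>
  ultimately have 2: "orthogonal_on ?Q A (parastrophe_13 ?Q A) \<longleftrightarrow>
      bij_betw (pointwise_sum G \<phi> id) ?Q ?Q"
    using c by blast

  have "orthogonal_on ?Q A (parastrophe_23 ?Q A) \<longleftrightarrow> (\<forall>b\<in>?Q. bij_betw (\<lambda>x. A x (A x b)) ?Q ?Q)"
    by (rule orthogonal_on_iff_bij_betw_snd) (use Ac parastrophe_23_iff[OF q] in auto)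
  moreover have "bij_betw (\<lambda>x. A x (A x b)) ?Q ?Q \<longleftrightarrow> bij_betw (pointwise_sum G id \<psi>) ?Q ?Q"
    if m: "b \<in> ?Q" for b
  proof (rule bij_betw_sandwich_iff[OF _ b(1)])
    show "bij_betw (\<lambda>u. u \<otimes> (\<psi> (\<psi> b \<otimes> c) \<otimes> c)) ?Q ?Q"
      using m c by (intro bij_betw_mult_right) simp
  qed (use m in \<open>simp_all add: simps\<close>)
  ultimately have 3: "orthogonal_on ?Q A (parastrophe_23 ?Q A) \<longleftrightarrow>
      bij_betw (pointwise_sum G id \<psi>) ?Q ?Q"
    using c by blast

  have "orthogonal_on ?Q A (parastrophe_123 ?Q A) \<longleftrightarrow> (\<forall>b\<in>?Q. bij_betw (\<lambda>x. A x (A b x)) ?Q ?Q)"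
    by (rule orthogonal_on_iff_bij_betw_snd) (use Ac parastrophe_123_iff[OF q] in auto)
  \<comment> \<open>The constant \<open>\<psi> (\<phi> b)\<close> stands between
    \<open>\<phi> x\<close> and \<open>\<psi> (\<psi> x)\<close> and cannot be moved past them
    without commutativity. Shifting the argument on the left produces it in that place;
    \<open>L\<close> removes the extra leading factor \<open>\<phi> ?p\<close>.\<close>
  moreover have "bij_betw (\<lambda>x. A x (A b x)) ?Q ?Q \<longleftrightarrow>
      bij_betw (pointwise_sum G \<phi> (\<psi> \<circ> \<psi>)) ?Q ?Q" if m: "b \<in> ?Q" for b
  proof (rule bij_betw_sandwich_iff)
    \<comment> \<open>\<open>p\<close> is chosen so that \<open>\<psi> (\<psi> p) = \<psi> (\<phi> b)\<close>.\<close>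
    let ?p = "\<psi>' (\<phi> b)"
    show "bij_betw ((\<lambda>u. u \<otimes> (\<psi> c \<otimes> c)) \<circ> (\<lambda>u. inv (\<phi> ?p) \<otimes> u)) ?Q ?Q"
      using m c by (intro bij_betw_trans[OF bij_betw_mult_left bij_betw_mult_right]) auto
    show "bij_betw (\<lambda>x. ?p \<otimes> x) ?Q ?Q"
      using m by (intro bij_betw_mult_left) simp
  qed (use m in \<open>simp_all add: simps\<close>)
  ultimately have 4: "orthogonal_on ?Q A (parastrophe_123 ?Q A) \<longleftrightarrow>
      bij_betw (pointwise_sum G \<phi> (\<psi> \<circ> \<psi>)) ?Q ?Q"
    using c by blast

  have "orthogonal_on ?Q A (parastrophe_132 ?Q A) \<longleftrightarrow> (\<forall>b\<in>?Q. bij_betw (\<lambda>y. A (A y b) y) ?Q ?Q)"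
    by (rule orthogonal_on_iff_bij_betw_fst) (use Ac parastrophe_132_iff[OF q] in auto)
  \<comment> \<open>Here the constant \<open>\<phi> (\<psi> b \<otimes> c)\<close> is trapped
    between \<open>\<phi> (\<phi> y)\<close> and \<open>\<psi> y\<close>. A shift on the right
    produces it, and \<open>L\<close> cancels the extra trailing factor
    \<open>\<psi> ?p\<close>.\<close>
  moreover have "bij_betw (\<lambda>y. A (A y b) y) ?Q ?Q \<longleftrightarrow>
      bij_betw (pointwise_sum G (\<phi> \<circ> \<phi>) \<psi>) ?Q ?Q" if m: "b \<in> ?Q" for b
  proof (rule bij_betw_sandwich_iff)
    \<comment> \<open>\<open>p\<close> is chosen so that \<open>\<phi> (\<phi> p) = \<phi> (\<psi> b \<otimes> c)\<close>.\<close>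
    let ?p = "\<phi>' (\<psi> b \<otimes> c)"
    show "bij_betw (\<lambda>u. u \<otimes> (inv (\<psi> ?p) \<otimes> c)) ?Q ?Q"
      using m c by (intro bij_betw_mult_right) simp
    show "bij_betw (\<lambda>y. y \<otimes> ?p) ?Q ?Q"
      using m c by (intro bij_betw_mult_right) simp
  qed (use m in \<open>simp_all add: simps\<close>)
  ultimately have 5: "orthogonal_on ?Q A (parastrophe_132 ?Q A) \<longleftrightarrow>
      bij_betw (pointwise_sum G (\<phi> \<circ> \<phi>) \<psi>) ?Q ?Q"
    using c by blast

  show ?thesis
    using 1 2 3 4 5 unfolding \<phi>'_def \<psi>'_def by blast
qed

end
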